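(* Let $n$ and $r$ be positive integers, let $L\subset\mathbb{N}$ be a set with $|L|=s\geq 1$, and let $\mathcal{F}$ be an $L$-intersecting, $n$-uniform set family. Let $m=\max\{r-1,\,n^2-n+1\}$. If \[|\mathcal{F}|> 2^{\,n\log_2(s+1)+s\log_2(m)},\] then $\mathcal{F}$ contains an $r$-sunflower.
   Context: A set family over a finite set $X$ is a collection of subsets of $X$; it is $n$-uniform if every member has exactly $n$ elements. For $L\subset\mathbb{N}$ (here $\mathbb{N}$ includes $0$), a family $\mathcal{F}$ is $L$-intersecting if $|F_i\cap F_j|\in L$ for all distinct $F_i,F_j\in\mathcal{F}$. An $r$-sunflower is a collection of $r$ distinct sets $S_1,\dots,S_r$ such that $S_i\cap S_j=S_1\cap S_2\cap\cdots\cap S_r$ for all $i\neq j$. "$\mathcal{F}$ contains an $r$-sunflower" means some $r$ distinct members of $\mathcal{F}$ form an $r$-sunflower. *)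

theory Defs
  imports Complex_Main
begin

definition set_family_over :: "'a set \<Rightarrow> 'a set set \<Rightarrow> bool" where
  "set_family_over X F \<longleftrightarrow> finite X \<and> F \<subseteq> Pow X"

definition uniform_family :: "nat \<Rightarrow> 'a set set \<Rightarrow> bool" where
  "uniform_family n F \<longleftrightarrow> (\<forall>A\<in>F. finite A \<and> card A = n)"

definition intersecting_family :: "nat set \<Rightarrow> 'a set set \<Rightarrow> bool" where
  "intersecting_family L F \<longleftrightarrow>
     (\<forall>A\<in>F. \<forall>B\<in>F. A \<noteq> B \<longrightarrow> finite (A \<inter> B) \<and> card (A \<inter> B) \<in> L)"

(* The r distinct sets are given as the collection S of cardinality r. *)
definition sunflower :: "nat \<Rightarrow> 'a set set \<Rightarrow> bool" where
  "sunflower r S \<longleftrightarrow>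
     finite S \<and> card S = r \<and> (\<forall>A\<in>S. \<forall>B\<in>S. A \<noteq> B \<longrightarrow> A \<inter> B = \<Inter>S)"

definition contains_sunflower :: "nat \<Rightarrow> 'a set set \<Rightarrow> bool" where
  "contains_sunflower r F \<longleftrightarrow> (\<exists>S\<subseteq>F. sunflower r S)"

end

theory Submission
  imports Defs
begin

text \<open>Let \<open>l\<close> be the least element of \<open>L\<close>, fix a member \<open>F\<^sub>0\<close> of a family \<open>F\<close> without
  \<open>r\<close>-sunflower, and choose \<open>B \<subseteq> F\<^sub>0\<close> with \<open>l\<close> elements. Among the members containing \<open>B\<close>, a maximal
  subfamily with all pairwise intersections equal to \<open>B\<close> is a sunflower, so it has at most \<open>r - 1\<close>
  members, and every other member meets one of them, \<open>G\<close> say, in more than \<open>l\<close> points. Now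
  continue with \<open>G\<close> in the place of \<open>F\<^sub>0\<close> and \<open>L - {l}\<close> in the place of \<open>L\<close>. The subsets \<open>B\<close>
  chosen along the way form a chain in an \<open>n\<close>-set; a multinomial coefficient with
  \<open>s + 1\<close> parts, hence at most \<open>(s + 1) ^ n\<close>, counts these chains. So the family has at most
  \<open>(s + 1) ^ n * m ^ s\<close> members.\<close>

lemma contains_sunflower_mono:
  "contains_sunflower r F \<Longrightarrow> F \<subseteq> G \<Longrightarrow> contains_sunflower r G"
  unfolding contains_sunflower_def by blast

text \<open>Two distinct members suffice to identify \<open>B\<close> with \<open>\<Inter>S\<close>:
  \<open>B\<close> is their intersection, and any further member contains \<open>B\<close> because
  it meets one of them in \<open>B\<close>.\<close>

lemma sunflower_if_pairwise_inter_eq: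
  assumes "finite S" "card S = r" "pairwise (\<lambda>F G. F \<inter> G = B) S"
  shows "sunflower r S"
proof -
  have "F \<inter> G = \<Inter>S" if "F \<in> S" "G \<in> S" "F \<noteq> G" for F G
  proof -
    have "B \<subseteq> D" if "D \<in> S" for D
      using assms(3) \<open>F \<in> S\<close> \<open>G \<in> S\<close> \<open>F \<noteq> G\<close> that unfolding pairwise_def by blast
    then show ?thesis
      using assms(3) that unfolding pairwise_def by blast
  qed
  then show ?thesis
    using assms unfolding sunflower_def by blast
qed

lemma card_pairwise_inter_less:
  assumes "\<not> contains_sunflower r H" "S \<subseteq> H" "finite S" "pairwise (\<lambda>F G. F \<inter> G = B) S"
  shows "card S < r"
proof (rule ccontr)
  assume "\<not> card S < r"
  then obtain T where "T \<subseteq> S" "card T = r" "finite T"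
    by (metis not_less obtain_subset_with_card_n)
  moreover have "pairwise (\<lambda>F G. F \<inter> G = B) T"
    using assms(4) \<open>T \<subseteq> S\<close> by (rule pairwise_subset)
  ultimately have "sunflower r T"
    by (blast intro: sunflower_if_pairwise_inter_eq)
  with assms(1,2) \<open>T \<subseteq> S\<close> show False
    unfolding contains_sunflower_def by blast
qed

lemma maximal_pairwise_subset:
  assumes "finite H"
  obtains S where "S \<subseteq> H" "pairwise P S"
    "\<And>x. x \<in> H \<Longrightarrow> x \<notin> S \<Longrightarrow> \<exists>y\<in>S. \<not> P x y \<or> \<not> P y x"
proof -
  let ?C = "{S. S \<subseteq> H \<and> pairwise P S}"
  have "{} \<in> ?C" by simp
  then have "?C \<noteq> {}" by (metis empty_iff)
  have "finite ?C" using assms by simp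
  from finite_has_maximal[OF this \<open>?C \<noteq> {}\<close>]
  obtain S where S: "S \<in> ?C" and max: "\<forall>T\<in>?C. S \<subseteq> T \<longrightarrow> S = T"
    by (elim bexE)
  have "\<exists>y\<in>S. \<not> P x y \<or> \<not> P y x" if "x \<in> H" "x \<notin> S" for x
  proof (rule ccontr)
    assume "\<not> ?thesis"
    with S that have "insert x S \<in> ?C"
      by (auto simp: pairwise_insert)
    with max that show False by blast
  qed
  with S that show thesis by blast
qed

lemma card_supersets_within:
  assumes "finite F" "A \<subseteq> F" "card A \<le> l"
  shows "card {B. A \<subseteq> B \<and> B \<subseteq> F \<and> card B = l} = (card F - card A) choose (l - card A)"
proof -
  have fin: "finite A" using assms finite_subset by blast
  have "bij_betw (\<lambda>C. A \<union> C) {C. C \<subseteq> F - A \<and> card C = l - card A}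
      {B. A \<subseteq> B \<and> B \<subseteq> F \<and> card B = l}"
  proof (rule bij_betw_byWitness[where f' = "\<lambda>B. B - A"])
    show "(\<lambda>C. A \<union> C) ` {C. C \<subseteq> F - A \<and> card C = l - card A}
        \<subseteq> {B. A \<subseteq> B \<and> B \<subseteq> F \<and> card B = l}"
    proof (intro image_subsetI)
      fix C assume "C \<in> {C. C \<subseteq> F - A \<and> card C = l - card A}"
      then have C: "C \<subseteq> F - A" "card C = l - card A" by auto
      then have "finite C" using assms(1) finite_subset by blast
      with C fin assms have "card (A \<union> C) = l"
        by (subst card_Un_disjoint) auto
      with C assms show "A \<union> C \<in> {B. A \<subseteq> B \<and> B \<subseteq> F \<and> card B = l}" by blast
    qed
  qed (use fin in \<open>auto simp: card_Diff_subset\<close>)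
  then have "card {B. A \<subseteq> B \<and> B \<subseteq> F \<and> card B = l} = card {C. C \<subseteq> F - A \<and> card C = l - card A}"
    by (simp add: bij_betw_same_card)
  also have "\<dots> = (card F - card A) choose (l - card A)"
    using assms fin by (simp add: n_subsets card_Diff_subset)
  finally show ?thesis .
qed

text \<open>The left side is one term of the binomial expansion of \<open>(1 + a) ^ n\<close>. In
  the induction this absorbs the choice of \<open>B\<close> by raising the base from
  \<open>s + 1\<close> to \<open>s + 2\<close>.\<close>

lemma binomial_times_power_le:
  fixes a :: nat
  assumes "k \<le> n"
  shows "(n choose k) * a ^ (n - k) \<le> (a + 1) ^ n"
proof -
  have "(n choose k) * a ^ (n - k) = (n choose k) * 1 ^ k * a ^ (n - k)" by simp
  also have "\<dots> \<le> (\<Sum>k\<le>n. (n choose k) * 1 ^ k * a ^ (n - k))"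
    using assms by (intro member_le_sum) auto
  also have "\<dots> = (a + 1) ^ n"
    using binomial[of 1 a n] by (simp add: add.commute)
  finally show ?thesis .
qed

text \<open>Passing from \<open>L\<close> to \<open>L - {l}\<close> does not make the intersections of size \<open>l\<close> disappear;
  hence pairwise intersections smaller than all of \<open>L\<close> are permitted, and only the intersections
  with \<open>F\<^sub>0\<close>, which need not be a member, are required to lie in \<open>L\<close>.\<close>

lemma card_sunflower_free_le:
  fixes H :: "'a set set"
  assumes "1 \<le> m" "r - 1 \<le> m"
    and "finite L" "card L = s" "\<forall>l\<in>L. card A \<le> l"
    and "finite H" "\<forall>F\<in>H. finite F \<and> card F = n"
    and "finite F\<^sub>0" "card F\<^sub>0 = n" "A \<subseteq> F\<^sub>0"
    and "\<forall>F\<in>H. A \<subseteq> F" "\<forall>F\<in>H. F \<noteq> F\<^sub>0 \<longrightarrow> card (F \<inter> F\<^sub>0) \<in> L"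
    and "\<forall>F\<in>H. \<forall>G\<in>H. F \<noteq> G \<longrightarrow> card (F \<inter> G) \<in> L \<or> (\<forall>l\<in>L. card (F \<inter> G) < l)"
    and "\<not> contains_sunflower r H"
  shows "card H \<le> (s + 1) ^ (n - card A) * m ^ s"
  using assms(3-)
proof (induction s arbitrary: L A F\<^sub>0 H)
  case 0
  \<comment> \<open>Here \<open>L\<close> is empty, so no member other than \<open>F\<^sub>0\<close>
    is possible.\<close>
  then have "H \<subseteq> {F\<^sub>0}" by auto
  then have "card H \<le> 1" using card_mono[of "{F\<^sub>0}" H] by simp
  then show ?case by simp
next
  case (Suc s)
  define l where "l = Min L"
  have "L \<noteq> {}" using Suc.prems(2) by auto
  then have l: "l \<in> L" "\<And>k. k \<in> L \<Longrightarrow> l \<le> k"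
    using Suc.prems(1) by (auto simp: l_def)
  show ?case
  \<comment> \<open>For \<open>l > n\<close> every intersection with \<open>F\<^sub>0\<close> is too
    small to have its size in \<open>L\<close>. Otherwise
    \<open>l - card A \<le> n - card A\<close>, as the final binomial estimate requires.\<close>
  proof (cases "l \<le> n")
    case False
    have "H \<subseteq> {F\<^sub>0}"
    proof clarsimp
      fix F assume "F \<in> H"
      show "F = F\<^sub>0"
      proof (rule ccontr)
        assume "F \<noteq> F\<^sub>0"
        then have "l \<le> card (F \<inter> F\<^sub>0)" using Suc.prems(10) \<open>F \<in> H\<close> l by blast
        also have "\<dots> \<le> n" using Suc.prems(6,7) by (auto intro: card_mono)
        finally show False using False by simp
      qed
    qed
    then have "card H \<le> 1" using card_mono[of "{F\<^sub>0}" H] by simp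
    also have "1 \<le> (Suc s + 1) ^ (n - card A) * m ^ Suc s"
      using assms(1) by (simp add: Suc_le_eq)
    finally show ?thesis .
  next
    case True
    define \<B> where "\<B> = {B. A \<subseteq> B \<and> B \<subseteq> F\<^sub>0 \<and> card B = l}"
    have al: "card A \<le> l" using Suc.prems(3) l by blast
    have card_\<B>: "card \<B> = (n - card A) choose (l - card A)"
      unfolding \<B>_def using card_supersets_within[of F\<^sub>0 A l] Suc.prems(6-8) al by simp
    have fin_\<B>: "finite \<B>"
      by (rule finite_subset[of _ "Pow F\<^sub>0"]) (use Suc.prems(6) in \<open>auto simp: \<B>_def\<close>)
    define K where "K B = {F \<in> H. B \<subseteq> F}" for B
    have H_sub: "H \<subseteq> (\<Union>B\<in>\<B>. K B)"
    proof
      fix F assume F: "F \<in> H"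
      have "l \<le> card (F \<inter> F\<^sub>0)"
        using Suc.prems(7,10) F l True by (cases "F = F\<^sub>0") auto
      moreover have "A \<subseteq> F \<inter> F\<^sub>0" "finite (F \<inter> F\<^sub>0)" using Suc.prems(6,8,9) F by auto
      ultimately obtain B where "A \<subseteq> B" "B \<subseteq> F \<inter> F\<^sub>0" "card B = l"
        using exists_subset_between[of A l "F \<inter> F\<^sub>0"] al by blast
      with F show "F \<in> (\<Union>B\<in>\<B>. K B)" by (auto simp: \<B>_def K_def)
    qed
    have K: "card (K B) \<le> m * ((s + 1) ^ (n - l) * m ^ s)" if "B \<in> \<B>" for B
    proof -
      have B: "card B = l" "finite B"
        using that Suc.prems(6) finite_subset unfolding \<B>_def by blast+
      have fin: "finite (K B)" using Suc.prems(4) by (simp add: K_def)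
      obtain S where S: "S \<subseteq> K B" "pairwise (\<lambda>F G. F \<inter> G = B) S"
        and max: "\<And>F. F \<in> K B \<Longrightarrow> F \<notin> S \<Longrightarrow> \<exists>G\<in>S. F \<inter> G \<noteq> B \<or> G \<inter> F \<noteq> B"
        using maximal_pairwise_subset[OF fin, where P = "\<lambda>F G. F \<inter> G = B"] by blast
      have finS: "finite S" using S fin finite_subset by blast
      have "card S < r"
        using card_pairwise_inter_less[OF Suc.prems(12) _ finS S(2)] S(1) by (auto simp: K_def)
      then have cardS: "card S \<le> m" using assms(2) by simp
      \<comment> \<open>By maximality of \<open>S\<close> these sets cover \<open>K B\<close>; the
        disjunct \<open>F = G\<close> keeps \<open>G\<close> itself in \<open>J G\<close> even when
        \<open>G = B\<close>.\<close>
      define J where "J G = {F \<in> K B. F = G \<or> F \<inter> G \<noteq> B}" for G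
      have "card (J G) \<le> (s + 1) ^ (n - l) * m ^ s" if "G \<in> S" for G
      proof -
        have G: "G \<in> H" "B \<subseteq> G" using that S(1) by (auto simp: K_def)
        have J: "J G \<subseteq> H" "\<And>F. F \<in> J G \<Longrightarrow> B \<subseteq> F" by (auto simp: J_def K_def)
        have "card (J G) \<le> (s + 1) ^ (n - card B) * m ^ s"
        proof (rule Suc.IH[where L = "L - {l}" and F\<^sub>0 = G])
          show "\<forall>F\<in>J G. F \<noteq> G \<longrightarrow> card (F \<inter> G) \<in> L - {l}"
          proof (intro ballI impI)
            fix F assume F: "F \<in> J G" "F \<noteq> G"
            \<comment> \<open>Containing \<open>B\<close> properly makes the intersection larger
              than \<open>l\<close>, which excludes both the size \<open>l\<close> and the
              alternative of lying below all of \<open>L\<close>.\<close>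
            then have "F \<in> H" "B \<subset> F \<inter> G" using G by (auto simp: J_def K_def)
            moreover from this have "card B < card (F \<inter> G)"
              using Suc.prems(5) by (intro psubset_card_mono) auto
            moreover have "card (F \<inter> G) \<in> L \<or> card (F \<inter> G) < l"
              using Suc.prems(11) G(1) F(2) l(1) \<open>F \<in> H\<close> by blast
            ultimately show "card (F \<inter> G) \<in> L - {l}"
              using B(1) by auto
          qed
          show "\<forall>F\<in>J G. \<forall>F'\<in>J G. F \<noteq> F' \<longrightarrow>
              card (F \<inter> F') \<in> L - {l} \<or> (\<forall>k\<in>L - {l}. card (F \<inter> F') < k)"
          proof (intro ballI impI)
            fix F F' assume "F \<in> J G" "F' \<in> J G" "F \<noteq> F'"
            then have "card (F \<inter> F') \<in> L \<or> (\<forall>k\<in>L. card (F \<inter> F') < k)"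
              using Suc.prems(11) J(1) by blast
            \<comment> \<open>An intersection of size \<open>l\<close> now falls under the second
              alternative.\<close>
            moreover have "\<forall>k\<in>L - {l}. l < k"
              using l(2) by (simp add: order_le_less) blast
            ultimately show "card (F \<inter> F') \<in> L - {l} \<or> (\<forall>k\<in>L - {l}. card (F \<inter> F') < k)"
              by blast
          qed
          show "\<not> contains_sunflower r (J G)"
            using Suc.prems(12) J(1) contains_sunflower_mono by blast
          show "finite (J G)" using J(1) Suc.prems(4) finite_subset by blast
        qed (use Suc.prems(1,2,5) G J l B in auto)
        then show ?thesis by (simp add: B)
      qed
      moreover have "K B \<subseteq> (\<Union>G\<in>S. J G)"
      proof
        fix F assume F: "F \<in> K B"
        show "F \<in> (\<Union>G\<in>S. J G)"
          using max[OF F] F by (cases "F \<in> S") (auto simp: J_def Int_commute)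
      qed
      then have "card (K B) \<le> card (\<Union>G\<in>S. J G)"
        using fin finS by (intro card_mono) (auto simp: J_def)
      then have "card (K B) \<le> (\<Sum>G\<in>S. card (J G))"
        using card_UN_le[OF finS, of J] by linarith
      ultimately have "card (K B) \<le> card S * ((s + 1) ^ (n - l) * m ^ s)"
        using sum_bounded_above[of S "\<lambda>G. card (J G)"] by (metis le_trans of_nat_id)
      then show ?thesis using cardS by (meson le_trans mult_le_mono1)
    qed
    have "card H \<le> card (\<Union>B\<in>\<B>. K B)"
      using fin_\<B> H_sub Suc.prems(4) by (intro card_mono) (auto simp: K_def)
    also have "\<dots> \<le> (\<Sum>B\<in>\<B>. card (K B))"
      by (rule card_UN_le[OF fin_\<B>])
    also have "\<dots> \<le> card \<B> * (m * ((s + 1) ^ (n - l) * m ^ s))"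
      using sum_bounded_above[of \<B> "\<lambda>B. card (K B)", OF K] by simp
    \<comment> \<open>The exponent \<open>n - l\<close> is rewritten to fit
      \<open>binomial_times_power_le\<close>.\<close>
    also have "\<dots> = ((n - card A) choose (l - card A))
        * (s + 1) ^ ((n - card A) - (l - card A)) * m ^ Suc s"
      using al by (simp add: card_\<B> algebra_simps)
    also have "\<dots> \<le> (s + 1 + 1) ^ (n - card A) * m ^ Suc s"
      using True by (intro mult_le_mono1 binomial_times_power_le) simp
    finally show ?thesis by simp
  qed
qed

theorem theorem1p4:
  fixes X :: "'a set" and F :: "'a set set" and L :: "nat set" and n r s m :: nat
  assumes "n \<ge> 1" and "r \<ge> 1"
    and "finite L" and "card L = s" and "s \<ge> 1"
    and "set_family_over X F"
    and "uniform_family n F"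
    and "intersecting_family L F"
    and "m = max (r - 1) (n ^ 2 - n + 1)"
    and "real (card F) > 2 powr (real n * log 2 (real s + 1) + real s * log 2 (real m))"
  shows "contains_sunflower r F"
proof (rule ccontr)
  assume no: "\<not> contains_sunflower r F"
  have m: "1 \<le> m" "r - 1 \<le> m" using assms(9) by auto
  have "finite F"
    using assms(6) unfolding set_family_over_def by (meson finite_Pow_iff finite_subset)
  \<comment> \<open>To be applied to the bases \<open>s + 1\<close> and \<open>m\<close>, the latter
    positive by \<open>m(1)\<close>.\<close>
  have "2 powr (real k * log 2 x) = x ^ k" if "x > 0" for k x
    using that by (simp flip: log_nat_power)
  then have "2 powr (real n * log 2 (real s + 1) + real s * log 2 (real m))
      = real ((s + 1) ^ n * m ^ s)"
    using m(1) by (simp add: powr_add add.commute)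
  with assms(10) have large: "(s + 1) ^ n * m ^ s < card F"
    by (metis of_nat_less_iff)
  then obtain F\<^sub>0 where "F\<^sub>0 \<in> F" by fastforce
  \<comment> \<open>The induction starts from \<open>A = {}\<close>; as \<open>F\<^sub>0\<close> is
    a member, its intersections with the others have sizes in \<open>L\<close>.\<close>
  have "card F \<le> (s + 1) ^ (n - card ({} :: 'a set)) * m ^ s"
  proof (rule card_sunflower_free_le[where L = L and F\<^sub>0 = F\<^sub>0 and r = r])
    show "\<forall>A\<in>F. A \<noteq> F\<^sub>0 \<longrightarrow> card (A \<inter> F\<^sub>0) \<in> L"
      using assms(8) \<open>F\<^sub>0 \<in> F\<close> unfolding intersecting_family_def by blast
    show "\<forall>A\<in>F. \<forall>B\<in>F. A \<noteq> B \<longrightarrow> card (A \<inter> B) \<in> L \<or> (\<forall>l\<in>L. card (A \<inter> B) < l)"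
      using assms(8) unfolding intersecting_family_def by blast
  qed (use m no assms(3,4,7) \<open>finite F\<close> \<open>F\<^sub>0 \<in> F\<close> in \<open>auto simp: uniform_family_def\<close>)
  with large show False by simp
qed

end
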